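(* Let $T_1,T_2\in\mathcal{B}_A(\mathcal{H})$. Then $$w_{\mathbb{A}}^4\left(\begin{bmatrix}O&T_1\\ T_2&O\end{bmatrix}\right)\le\frac{1}{16}\|P\|_A^2+\frac14 w_A^2(T_2T_1)+\frac18 w_A(PT_2T_1+T_2T_1P),$$ where $P=T_1^{\#_A}T_1+T_2T_2^{\#_A}$.
   Context: $\mathcal{H}$ is a complex Hilbert space with inner product $\langle\cdot,\cdot\rangle$, $\mathcal{B}(\mathcal{H})$ is the algebra of bounded linear operators on $\mathcal{H}$, and $A\in\mathcal{B}(\mathcal{H})$ is a positive operator, i.e. $A$ is selfadjoint and $\langle Ax,x\rangle\ge 0$ for all $x$. Put $\langle x,y\rangle_A=\langle Ax,y\rangle$ and $\|x\|_A=\sqrt{\langle x,x\rangle_A}$. $\mathcal{R}(\cdot)$ denotes range, and $\mathcal{B}_A(\mathcal{H})=\{T\in\mathcal{B}(\mathcal{H}):\mathcal{R}(T^*A)\subseteq\mathcal{R}(A)\}$. For $T\in\mathcal{B}_A(\mathcal{H})$: $T^{\#_A}$ denotes the distinguished $A$-adjoint of $T$, i.e. the unique $X\in\mathcal{B}(\mathcal{H})$ with $AX=T^*A$ and $\mathcal{R}(X)\subseteq\overline{\mathcal{R}(A)}$ (equivalently $T^{\#_A}=A^\dagger T^*A$, with $A^\dagger$ the Moore-Penrose inverse of $A$); the $A$-operator seminorm is $\|T\|_A=\sup\{\|Tx\|_A/\|x\|_A: x\in\overline{\mathcal{R}(A)},\ x\ne 0\}$; and the $A$-numerical radius is $w_A(T)=\sup\{|\langle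 Tx,x\rangle_A|:x\in\mathcal{H},\ \|x\|_A=1\}$. $\mathbb{A}=\mathrm{diag}(A,A)$ is the positive operator on $\mathcal{H}\oplus\mathcal{H}$ with diagonal entries $A$, and $w_{\mathbb{A}}$ is defined in the same way with $\mathcal{H}\oplus\mathcal{H}$ and $\mathbb{A}$ in place of $\mathcal{H}$ and $A$. $w^k(\cdot)$ means $(w(\cdot))^k$. $O$ is the null operator on $\mathcal{H}$. *)

theory Defs
  imports "HOL-Analysis.Analysis"
begin

text \<open>
  The inner product is linear in its first and conjugate-linear in its second argument.
  The library's real normed structure (hence its topology and its notion of a bounded real-linear
  map) is reused: \<open>scaleC\<close> extends \<open>scaleR\<close>, and the norm is the one induced by \<open>cinner\<close>.
\<close>

class complex_inner = real_normed_vector +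
  fixes scaleC :: "complex \<Rightarrow> 'a \<Rightarrow> 'a"
    and cinner :: "'a \<Rightarrow> 'a \<Rightarrow> complex"
  assumes scaleC_add_right: "scaleC c (x + y) = scaleC c x + scaleC c y"
    and scaleC_add_left: "scaleC (c + d) x = scaleC c x + scaleC d x"
    and scaleC_scaleC: "scaleC c (scaleC d x) = scaleC (c * d) x"
    and scaleC_of_real: "scaleC (complex_of_real r) x = scaleR r x"
    and cinner_commute: "cinner x y = cnj (cinner y x)"
    and cinner_add_left: "cinner (x + y) z = cinner x z + cinner y z"
    and cinner_scaleC_left: "cinner (scaleC c x) y = c * cinner x y"
    and cinner_self_nonneg: "cinner x x \<in> \<real>\<^sub>\<ge>\<^sub>0"
    and cinner_self_eq_0_iff: "cinner x x = 0 \<longleftrightarrow> x = 0"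
    and norm_eq_sqrt_cinner: "norm x = sqrt (Re (cinner x x))"

class complex_hilbert = complex_inner + complete_space

instantiation prod :: (complex_inner, complex_inner) complex_inner
begin

definition scaleC_prod_def: "scaleC c p = (scaleC c (fst p), scaleC c (snd p))"

definition cinner_prod_def: "cinner p q = cinner (fst p) (fst q) + cinner (snd p) (snd q)"

instance
proof
  fix c d :: complex and r :: real and x y z :: "'a \<times> 'b"
  show "scaleC c (x + y) = scaleC c x + scaleC c y"
    by (simp add: scaleC_prod_def scaleC_add_right)
  show "scaleC (c + d) x = scaleC c x + scaleC d x"
    by (simp add: scaleC_prod_def scaleC_add_left)
  show "scaleC c (scaleC d x) = scaleC (c * d) x"
    by (simp add: scaleC_prod_def scaleC_scaleC)
  show "scaleC (complex_of_real r) x = scaleR r x"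
    by (simp add: scaleC_prod_def scaleC_of_real scaleR_prod_def)
  show "cinner x y = cnj (cinner y x)"
    by (simp add: cinner_prod_def cinner_commute[symmetric])
  show "cinner (x + y) z = cinner x z + cinner y z"
    by (simp add: cinner_prod_def cinner_add_left)
  show "cinner (scaleC c x) y = c * cinner x y"
    by (simp add: cinner_prod_def scaleC_prod_def cinner_scaleC_left distrib_left)
  have nonneg: "cinner (fst x) (fst x) \<in> \<real>\<^sub>\<ge>\<^sub>0" "cinner (snd x) (snd x) \<in> \<real>\<^sub>\<ge>\<^sub>0"
    by (rule cinner_self_nonneg)+
  then show "cinner x x \<in> \<real>\<^sub>\<ge>\<^sub>0"
    by (simp add: cinner_prod_def nonneg_Reals_add_I)
  have "cinner x x = 0 \<longleftrightarrow> cinner (fst x) (fst x) = 0 \<and> cinner (snd x) (snd x) = 0"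
    using nonneg by (auto simp: cinner_prod_def complex_nonneg_Reals_iff complex_eq_iff)
  then show "cinner x x = 0 \<longleftrightarrow> x = 0"
    by (simp add: cinner_self_eq_0_iff prod_eq_iff)
  show "norm x = sqrt (Re (cinner x x))"
    using nonneg
    by (simp add: norm_prod_def norm_eq_sqrt_cinner cinner_prod_def complex_nonneg_Reals_iff)
qed

end

instance prod :: (complex_hilbert, complex_hilbert) complex_hilbert ..

definition bounded_operators :: "('h::complex_inner \<Rightarrow> 'h) set" where
  "bounded_operators = {T. bounded_linear T \<and> (\<forall>c x. T (scaleC c x) = scaleC c (T x))}"

definition hilbert_adjoint :: "('h::complex_inner \<Rightarrow> 'h) \<Rightarrow> 'h \<Rightarrow> 'h" where
  "hilbert_adjoint T =
    (THE S. S \<in> bounded_operators \<and> (\<forall>x y. cinner (T x) y = cinner x (S y)))"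

definition positive_operator :: "('h::complex_inner \<Rightarrow> 'h) \<Rightarrow> bool" where
  "positive_operator A \<longleftrightarrow>
    A \<in> bounded_operators \<and> hilbert_adjoint A = A \<and> (\<forall>x. cinner (A x) x \<in> \<real>\<^sub>\<ge>\<^sub>0)"

definition A_inner :: "('h::complex_inner \<Rightarrow> 'h) \<Rightarrow> 'h \<Rightarrow> 'h \<Rightarrow> complex" where
  "A_inner A x y = cinner (A x) y"

definition A_norm :: "('h::complex_inner \<Rightarrow> 'h) \<Rightarrow> 'h \<Rightarrow> real" where
  "A_norm A x = sqrt (Re (A_inner A x x))"

definition A_adjointable :: "('h::complex_inner \<Rightarrow> 'h) \<Rightarrow> ('h \<Rightarrow> 'h) set" where
  "A_adjointable A =
    {T \<in> bounded_operators. range (hilbert_adjoint T \<circ> A) \<subseteq> range A}"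

definition A_adjoint :: "('h::complex_inner \<Rightarrow> 'h) \<Rightarrow> ('h \<Rightarrow> 'h) \<Rightarrow> 'h \<Rightarrow> 'h" where
  "A_adjoint A T =
    (THE X. X \<in> bounded_operators \<and> A \<circ> X = hilbert_adjoint T \<circ> A
      \<and> range X \<subseteq> closure (range A))"

text \<open>
  Both suprema are of nonnegative reals, and bounded for \<open>T\<close> in \<open>A_adjointable A\<close> with \<open>A\<close>
  positive. Inserting 0 only matters when the index set is empty (that is, when \<open>A = 0\<close>), where
  it fixes the value as 0; the library's \<open>Sup {}\<close> on the reals is unspecified.
\<close>

definition A_op_seminorm :: "('h::complex_inner \<Rightarrow> 'h) \<Rightarrow> ('h \<Rightarrow> 'h) \<Rightarrow> real" where
  "A_op_seminorm A T =
    Sup (insert 0 {A_norm A (T x) / A_norm A x | x. x \<in> closure (range A) \<and> x \<noteq> 0})"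

definition A_numerical_radius :: "('h::complex_inner \<Rightarrow> 'h) \<Rightarrow> ('h \<Rightarrow> 'h) \<Rightarrow> real" where
  "A_numerical_radius A T =
    Sup (insert 0 {cmod (A_inner A (T x) x) | x. A_norm A x = 1})"

definition block_operator ::
  "('h::complex_inner \<Rightarrow> 'h) \<Rightarrow> ('h \<Rightarrow> 'h) \<Rightarrow> ('h \<Rightarrow> 'h) \<Rightarrow> ('h \<Rightarrow> 'h) \<Rightarrow> 'h \<times> 'h \<Rightarrow> 'h \<times> 'h"
  where
  "block_operator T11 T12 T21 T22 = (\<lambda>(x, y). (T11 x + T12 y, T21 x + T22 y))"

definition null_operator :: "'h::complex_inner \<Rightarrow> 'h" where
  "null_operator = (\<lambda>x. 0)"

definition diag_operator :: "('h::complex_inner \<Rightarrow> 'h) \<Rightarrow> 'h \<times> 'h \<Rightarrow> 'h \<times> 'h" where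
  "diag_operator A = block_operator A null_operator null_operator A"

end

theory Submission
  imports Defs
begin

text \<open>
  Write \<open>B\<close> for the form \<open>A_inner A\<close> and \<open>T\<^sup>#\<close> for \<open>A_adjoint A T\<close>. At a vector \<open>(x, y)\<close> the form of the
  block operator is \<open>B (T1 y) x + B (T2 x) y\<close>. Multiplied by a suitable \<open>e\<close> of modulus one, it becomes
  the real part of \<open>B (Z y) x\<close> with \<open>Z = e T1 + cnj e T2\<^sup>#\<close>, so Cauchy--Schwarz bounds it by the
  product of the seminorms of \<open>Z y\<close> and \<open>x\<close>. The square of the seminorm of \<open>Z y\<close> is the form of
  \<open>Z\<^sup># Z = P + Q\<close> at \<open>y\<close>, where \<open>Q = e\<^sup>2 T2 T1 + cnj (e\<^sup>2) T1\<^sup># T2\<^sup>#\<close>. Squaring once more and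
  expanding \<open>(P + Q)\<^sup>2 = P\<^sup>2 + Q\<^sup>2 + (P Q + Q P)\<close> produces the three terms on the right: \<open>P\<^sup>2\<close> gives
  the operator seminorm of \<open>P\<close>; \<open>Q\<close> is symmetric, so its seminorm is at most its numerical radius,
  hence at most twice that of \<open>T2 T1\<close>; and the form of \<open>P Q + Q P\<close> is twice the real part of \<open>e\<^sup>2\<close>
  times the form of \<open>P T2 T1 + T2 T1 P\<close>. The factor \<open>1 / 16\<close> comes from bounding the product of the
  squared seminorms of \<open>x\<close> and \<open>y\<close>, whose sum is one, by \<open>1 / 4\<close>. This is
  \<open>off_diagonal_form_estimate\<close>, which holds for every positive semidefinite form.

  Three facts connect the estimate with the definitions. First, \<open>T\<^sup>#\<close> exists as a bounded operator
  (lemma \<open>A_adjoint\<close>): its values come from the orthogonal decomposition along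
  \<open>closure (range A)\<close>, its boundedness from Baire's theorem. Second, a bounded operator with a bounded
  \<open>A\<close>-adjoint is bounded in the \<open>A\<close>-seminorm (\<open>A_norm_bounded_if_adjoint_pair\<close>), so that the suprema
  on the right are taken over bounded sets. Third, the operator seminorm, although defined through
  vectors in \<open>closure (range A)\<close> only, bounds the operator on all vectors
  (\<open>A_norm_le_A_op_seminorm\<close>).
\<close>

lemma scaleC_minus_one: "scaleC (-1) x = - (x::'a::complex_inner)"
  using scaleC_of_real[of "-1" x] by simp

section \<open>Positive semidefinite sesquilinear forms\<close>

text \<open>
  The abstraction covers both the inner product itself and \<open>A_inner A\<close>. The latter
  degenerates on the kernel of \<open>A\<close>, so vectors and operators are compared through the values of the
  form only.
\<close>

locale positive_form =
  fixes B :: "'a::complex_inner \<Rightarrow> 'a \<Rightarrow> complex"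
  assumes add_left: "B (x + y) z = B x z + B y z"
    and scale_left: "B (scaleC c x) y = c * B x y"
    and commute: "B x y = cnj (B y x)"
    and self_nonneg: "0 \<le> Re (B x x)"
begin

definition seminorm :: "'a \<Rightarrow> real" where
  "seminorm x = sqrt (Re (B x x))"

text \<open>
  A relation and not a function: for a degenerate form a map has many adjoints. A map
  with an adjoint is linear up to vectors of seminorm zero, which is all that polarization needs.
\<close>

definition adjoint_pair :: "('a \<Rightarrow> 'a) \<Rightarrow> ('a \<Rightarrow> 'a) \<Rightarrow> bool" where
  "adjoint_pair T S \<longleftrightarrow> (\<forall>x y. B (T x) y = B x (S y))"

lemma minus_left: "B (- x) y = - B x y"
  using scale_left[of "-1" x y] by (simp add: scaleC_minus_one)

lemma diff_left: "B (x - y) z = B x z - B y z"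
  using add_left[of x "- y" z] by (simp add: minus_left)

lemma add_right: "B x (y + z) = B x y + B x z"
  by (metis add_left commute complex_cnj_add)

lemma scale_right: "B x (scaleC c y) = cnj c * B x y"
  by (metis scale_left commute complex_cnj_mult)

lemma minus_right: "B x (- y) = - B x y"
  using scale_right[of x "-1" y] by (simp add: scaleC_minus_one)

lemma diff_right: "B x (y - z) = B x y - B x z"
  using add_right[of x y "- z"] by (simp add: minus_right)

lemmas form_simps =
  add_left add_right diff_left diff_right minus_left minus_right scale_left scale_right

lemma self_real: "B x x = complex_of_real (Re (B x x))"
proof -
  have "Im (B x x) = 0"
    using arg_cong[OF commute[of x x], of Im] by simp
  then show ?thesis by (simp add: complex_eq_iff)
qed

lemma seminorm_nonneg [simp]: "0 \<le> seminorm x"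
  by (simp add: seminorm_def self_nonneg)

lemma seminorm_sq: "(seminorm x)\<^sup>2 = Re (B x x)"
  by (simp add: seminorm_def self_nonneg)

lemma seminorm_scale: "seminorm (scaleC c x) = cmod c * seminorm x"
proof -
  have "Re (B (scaleC c x) (scaleC c x)) = (cmod c)\<^sup>2 * Re (B x x)"
  proof -
    have "B (scaleC c x) (scaleC c x) = (c * cnj c) * B x x"
      by (simp add: form_simps)
    then show ?thesis
      by (simp add: complex_norm_square[symmetric] flip: of_real_power)
  qed
  then show ?thesis by (simp add: seminorm_def real_sqrt_mult)
qed

lemma seminorm_minus: "seminorm (- x) = seminorm x"
  by (simp add: seminorm_def form_simps)

text \<open>
  The step \<open>t * B x y\<close> has the phase of \<open>B x y\<close>, which turns the seminorm along \<open>x - c y\<close> into a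
  real quadratic in \<open>t\<close>. Its nonnegativity gives Cauchy--Schwarz; its minimality at \<open>t = 0\<close> gives
  orthogonality of a nearest point.
\<close>

lemma seminorm_sq_diff_multiple:
  "(seminorm (x - scaleC (of_real t * B x y) y))\<^sup>2 =
    (seminorm x)\<^sup>2 - 2 * t * (cmod (B x y))\<^sup>2 + t\<^sup>2 * (cmod (B x y))\<^sup>2 * (seminorm y)\<^sup>2"
proof -
  let ?k = "B x y"
  have yx: "B y x = cnj ?k" by (rule commute)
  have "B (x - scaleC (of_real t * ?k) y) (x - scaleC (of_real t * ?k) y) =
      B x x - 2 * of_real t * (?k * cnj ?k) + (of_real t)\<^sup>2 * (?k * cnj ?k) * B y y"
    by (simp add: form_simps yx algebra_simps power2_eq_square)
  also have "\<dots> = of_real (Re (B x x) - 2 * t * (cmod ?k)\<^sup>2 + t\<^sup>2 * (cmod ?k)\<^sup>2 * Re (B y y))"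
    by (subst (1) self_real, subst (2) self_real)
      (simp add: complex_norm_square[symmetric] del: complex_cnj_mult)
  finally show ?thesis by (simp add: seminorm_sq)
qed

lemma orthogonal_if_no_descent:
  assumes "\<And>t. (seminorm x)\<^sup>2 \<le> (seminorm (x - scaleC (of_real t * B x y) y))\<^sup>2"
  shows "B x y = 0"
proof (rule ccontr)
  assume "B x y \<noteq> 0"
  then have k: "0 < (cmod (B x y))\<^sup>2" by simp
  define b where "b = (seminorm y)\<^sup>2"
  have b: "0 \<le> b" by (simp add: b_def)
  define t where "t = 1 / (b + 1)"
  have t: "0 < t" "t * b < 2" using b by (auto simp: t_def field_simps)
  have "0 \<le> (cmod (B x y))\<^sup>2 * (t * (t * b - 2))"
    using assms[of t] seminorm_sq_diff_multiple[of x t y]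
    by (simp add: b_def algebra_simps power2_eq_square)
  with k have "0 \<le> t * (t * b - 2)" by (simp add: zero_le_mult_iff)
  with t show False by (simp add: zero_le_mult_iff)
qed

lemma Cauchy_Schwarz: "cmod (B x y) \<le> seminorm x * seminorm y"
proof (cases "seminorm y = 0")
  case True
  let ?k = "(cmod (B x y))\<^sup>2"
  have "?k = 0"
  proof (rule ccontr)
    assume "?k \<noteq> 0"
    \<comment> \<open>The quadratic is linear in \<open>t\<close> here; the chosen \<open>t\<close> makes its value \<open>-1\<close>.\<close>
    then have "0 \<le> (seminorm x)\<^sup>2 - ((seminorm x)\<^sup>2 + 1)"
      using seminorm_sq_diff_multiple[of x "((seminorm x)\<^sup>2 + 1) / (2 * ?k)" y] True
        zero_le_power2[of "seminorm (x - scaleC (of_real (((seminorm x)\<^sup>2 + 1) / (2 * ?k)) * B x y) y)"]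
      by simp
    then show False by simp
  qed
  then show ?thesis by simp
next
  case False
  let ?b = "(seminorm y)\<^sup>2"
  have b: "0 < ?b" using False by simp
  have "0 \<le> (seminorm x)\<^sup>2 - 2 * (1 / ?b) * (cmod (B x y))\<^sup>2
      + (1 / ?b)\<^sup>2 * (cmod (B x y))\<^sup>2 * ?b"
    using seminorm_sq_diff_multiple[of x "1 / ?b" y] by (metis zero_le_power2)
  also have "\<dots> = (seminorm x)\<^sup>2 - (cmod (B x y))\<^sup>2 / ?b"
    using b by (simp add: field_simps power2_eq_square)
  finally have "(cmod (B x y))\<^sup>2 \<le> (seminorm x * seminorm y)\<^sup>2"
    using b by (simp add: field_simps power_mult_distrib)
  then show ?thesis by (rule power2_le_imp_le) simp
qed

lemma seminorm_sq_add:
  "(seminorm (x + y))\<^sup>2 = (seminorm x)\<^sup>2 + (seminorm y)\<^sup>2 + 2 * Re (B x y)"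
proof -
  have "Re (B y x) = Re (B x y)" using arg_cong[OF commute[of y x], of Re] by simp
  then show ?thesis by (simp add: seminorm_sq form_simps)
qed

lemma parallelogram:
  "(seminorm (x + y))\<^sup>2 + (seminorm (x - y))\<^sup>2 = 2 * (seminorm x)\<^sup>2 + 2 * (seminorm y)\<^sup>2"
  using seminorm_sq_add[of x y] seminorm_sq_add[of x "- y"]
  by (simp add: seminorm_minus form_simps)

lemma seminorm_triangle: "seminorm (x + y) \<le> seminorm x + seminorm y"
proof (rule power2_le_imp_le)
  have "Re (B x y) \<le> seminorm x * seminorm y"
    using Cauchy_Schwarz[of x y] complex_Re_le_cmod order_trans by blast
  then show "(seminorm (x + y))\<^sup>2 \<le> (seminorm x + seminorm y)\<^sup>2"
    by (simp add: seminorm_sq_add power2_sum)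
qed simp

lemma adjoint_pairD: "adjoint_pair T S \<Longrightarrow> B (T x) y = B x (S y)"
  by (simp add: adjoint_pair_def)

lemma adjoint_pair_sym: "adjoint_pair T S \<Longrightarrow> adjoint_pair S T"
  unfolding adjoint_pair_def by (metis commute)

lemma adjoint_pair_comp:
  "adjoint_pair T S \<Longrightarrow> adjoint_pair T' S' \<Longrightarrow> adjoint_pair (\<lambda>x. T (T' x)) (\<lambda>x. S' (S x))"
  by (simp add: adjoint_pair_def)

lemma adjoint_pair_add:
  "adjoint_pair T S \<Longrightarrow> adjoint_pair T' S' \<Longrightarrow> adjoint_pair (\<lambda>x. T x + T' x) (\<lambda>x. S x + S' x)"
  by (simp add: adjoint_pair_def form_simps)

lemma adjoint_pair_scale:
  "adjoint_pair T S \<Longrightarrow> adjoint_pair (\<lambda>x. scaleC c (T x)) (\<lambda>x. scaleC (cnj c) (S x))"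
  by (simp add: adjoint_pair_def form_simps)

text \<open>
  For a symmetric map the numerical radius dominates the operator seminorm. Polarization and the
  parallelogram law bound \<open>Re (B (Q x) y)\<close> by the quadratic form, and \<open>y\<close> is then taken to be the
  multiple of \<open>Q x\<close> that has the seminorm of \<open>x\<close>.
\<close>

lemma self_adjoint_seminorm_le:
  assumes Q: "adjoint_pair Q Q" and k: "\<And>u. cmod (B (Q u) u) \<le> k * (seminorm u)\<^sup>2"
  shows "seminorm (Q x) \<le> k * seminorm x"
proof -
  have polar: "4 * Re (B (Q x) y) \<le> 2 * k * ((seminorm x)\<^sup>2 + (seminorm y)\<^sup>2)" for y
  proof -
    have Qxy: "B (Q x) y = B x (Q y)" "B (Q y) x = B y (Q x)"
      "B (Q x) x = B x (Q x)" "B (Q y) y = B y (Q y)"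
      using Q by (simp_all add: adjoint_pair_def)
    have yx: "Re (B y (Q x)) = Re (B (Q x) y)"
      using arg_cong[OF commute[of y "Q x"], of Re] by simp
    have "B (Q (x + y)) (x + y) = B (Q x) (x + y) + B (Q y) (x + y)"
      using Q by (simp add: adjoint_pair_def add_left)
    moreover have "B (Q (x - y)) (x - y) = B (Q x) (x - y) - B (Q y) (x - y)"
      using Q by (simp add: adjoint_pair_def diff_left)
    ultimately have "4 * Re (B (Q x) y) =
        Re (B (Q (x + y)) (x + y)) - Re (B (Q (x - y)) (x - y))"
      using yx Qxy by (simp add: form_simps)
    also have "\<dots> \<le> cmod (B (Q (x + y)) (x + y)) + cmod (B (Q (x - y)) (x - y))"
      using abs_Re_le_cmod[of "B (Q (x + y)) (x + y)"] abs_Re_le_cmod[of "B (Q (x - y)) (x - y)"]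
      by linarith
    also have "\<dots> \<le> k * ((seminorm (x + y))\<^sup>2 + (seminorm (x - y))\<^sup>2)"
      using k[of "x + y"] k[of "x - y"] by (simp add: distrib_left)
    finally show ?thesis unfolding parallelogram by (simp add: algebra_simps)
  qed
  show ?thesis
  proof (cases "seminorm x = 0 \<or> seminorm (Q x) = 0")
    case True
    have "seminorm (Q x) = 0" if "seminorm x = 0"
    proof -
      have "(seminorm (Q x))\<^sup>2 = Re (B x (Q (Q x)))"
        using Q by (simp add: seminorm_sq adjoint_pair_def)
      also have "\<dots> \<le> seminorm x * seminorm (Q (Q x))"
        using Cauchy_Schwarz[of x "Q (Q x)"] complex_Re_le_cmod order_trans by blast
      finally show ?thesis using that by simp
    qed
    moreover have "0 \<le> k * seminorm x"
    proof (cases "seminorm x = 0")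
      case False
      have "0 \<le> k * (seminorm x)\<^sup>2" using k[of x] norm_ge_zero order_trans by blast
      with False show ?thesis by (simp add: zero_le_mult_iff)
    qed simp
    ultimately show ?thesis using True by auto
  next
    case False
    then have pos: "0 < seminorm x" "0 < seminorm (Q x)"
      by (auto simp: less_le)
    define s where "s = seminorm x / seminorm (Q x)"
    have s: "0 < s" "s * seminorm (Q x) = seminorm x" using pos by (auto simp: s_def)
    let ?y = "scaleC (of_real s) (Q x)"
    have "seminorm ?y = seminorm x" using s by (simp add: seminorm_scale)
    moreover have "Re (B (Q x) ?y) = s * (seminorm (Q x))\<^sup>2"
      by (simp add: form_simps seminorm_sq)
    ultimately have "4 * (s * (seminorm (Q x))\<^sup>2) \<le> 2 * k * ((seminorm x)\<^sup>2 + (seminorm x)\<^sup>2)"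
      using polar[of ?y] by simp
    moreover have "s * (seminorm (Q x))\<^sup>2 = seminorm x * seminorm (Q x)"
      using s(2) by (simp add: power2_eq_square flip: mult.assoc)
    ultimately have "seminorm x * seminorm (Q x) \<le> k * (seminorm x)\<^sup>2"
      by simp
    then have "seminorm x * seminorm (Q x) \<le> seminorm x * (k * seminorm x)"
      by (simp add: power2_eq_square algebra_simps)
    then show ?thesis using pos by simp
  qed
qed

text \<open>
  The seminorms \<open>a n\<close> of \<open>W\<^sup>n x\<close> form a log-convex sequence, by Cauchy--Schwarz and the symmetry of
  \<open>W\<close>. If \<open>a 1 / a 0\<close> exceeded \<open>K\<close>, the sequence would grow at least as fast as a geometric one
  with ratio greater than \<open>K\<close>, against the bound \<open>L * K ^ n * norm x\<close>.
\<close>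

lemma self_adjoint_seminorm_le_norm_bound:
  assumes W: "adjoint_pair W W"
    and dom: "\<And>x. seminorm x \<le> L * norm x"
    and K: "0 < K" "\<And>x. norm (W x) \<le> K * norm x"
  shows "seminorm (W x) \<le> K * seminorm x"
proof (rule ccontr)
  define a where "a n = seminorm ((W ^^ n) x)" for n
  assume "\<not> seminorm (W x) \<le> K * seminorm x"
  then have a1: "K * a 0 < a 1" by (simp add: a_def)
  have nonneg: "0 \<le> a n" for n by (simp add: a_def)
  have log_convex: "(a (Suc n))\<^sup>2 \<le> a n * a (Suc (Suc n))" for n
  proof -
    have "(a (Suc n))\<^sup>2 = Re (B ((W ^^ n) x) ((W ^^ Suc (Suc n)) x))"
      using W by (simp add: a_def seminorm_sq adjoint_pair_def)
    also have "\<dots> \<le> a n * a (Suc (Suc n))"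
      unfolding a_def using Cauchy_Schwarz complex_Re_le_cmod order_trans by blast
    finally show ?thesis .
  qed
  have "a 0 \<noteq> 0"
    using log_convex[of 0] a1 by auto
  then have a0: "0 < a 0" using nonneg[of 0] by simp
  define r where "r = a 1 / a 0"
  have r: "K < r" using a0 a1 by (simp add: r_def field_simps)
  have "0 < r" using r K by simp
  have growth: "0 < a n \<and> r * a n \<le> a (Suc n)" for n
  proof (induction n)
    case 0
    then show ?case using a0 by (simp add: r_def)
  next
    case (Suc n)
    then have n: "0 < a n" "r * a n \<le> a (Suc n)" by auto
    have S: "0 < a (Suc n)" using n \<open>0 < r\<close> mult_pos_pos[of r "a n"] by linarith
    have "a n * (r * a (Suc n)) \<le> a (Suc n) * a (Suc n)"
      using mult_right_mono[OF n(2), of "a (Suc n)"] S by (simp add: algebra_simps)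
    also have "\<dots> \<le> a n * a (Suc (Suc n))"
      using log_convex[of n] by (simp add: power2_eq_square)
    finally show ?case using n S by simp
  qed
  have lower: "r ^ n * a 0 \<le> a n" for n
  proof (induction n)
    case (Suc n)
    have "r ^ Suc n * a 0 \<le> r * a n"
      using mult_left_mono[OF Suc, of r] \<open>0 < r\<close> by (simp add: algebra_simps)
    with growth[of n] show ?case by linarith
  qed simp
  have power_norm: "norm ((W ^^ n) x) \<le> K ^ n * norm x" for n
  proof (induction n)
    case (Suc n)
    have "norm ((W ^^ Suc n) x) \<le> K * norm ((W ^^ n) x)" using K by simp
    also have "\<dots> \<le> K * (K ^ n * norm x)" using Suc K by (intro mult_left_mono) auto
    finally show ?case by (simp add: algebra_simps)
  qed simp
  have "0 < L * norm x" using a0 dom[of x] by (simp add: a_def)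
  then have L: "0 < L" by (simp add: zero_less_mult_iff)
  have bound: "(r / K) ^ n \<le> L * norm x / a 0" for n
  proof -
    have "a n \<le> L * norm ((W ^^ n) x)" by (simp add: a_def dom)
    also have "\<dots> \<le> L * (K ^ n * norm x)"
      using L power_norm by (intro mult_left_mono) auto
    finally have "r ^ n * a 0 \<le> L * (K ^ n * norm x)" using lower[of n] by linarith
    then show ?thesis using K a0 by (simp add: power_divide field_simps)
  qed
  have "1 < r / K" using r K by simp
  then obtain n where "L * norm x / a 0 < (r / K) ^ n"
    using real_arch_pow by blast
  with bound[of n] show False by simp
qed

text \<open>
  Apply the preceding bound to the symmetric map \<open>S \<circ> T\<close>, using
  \<open>(seminorm (T x))\<^sup>2 = Re (B x (S (T x)))\<close>.
\<close>

lemma adjoint_pair_seminorm_bounded: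
  assumes TS: "adjoint_pair T S"
    and dom: "\<And>x. seminorm x \<le> L * norm x"
    and T: "\<And>x. norm (T x) \<le> KT * norm x" and S: "\<And>x. norm (S x) \<le> KS * norm x"
  obtains C where "\<And>x. seminorm (T x) \<le> C * seminorm x"
proof -
  \<comment> \<open>The absolute values and the added 1 make the constant positive, whatever \<open>KS\<close> and \<open>KT\<close>.\<close>
  define K where "K = (\<bar>KS\<bar> + 1) * (\<bar>KT\<bar> + 1)"
  have K: "0 < K" unfolding K_def by (intro mult_pos_pos) auto
  have "norm (S (T x)) \<le> K * norm x" for x
  proof -
    have "norm (S (T x)) \<le> (\<bar>KS\<bar> + 1) * norm (T x)"
      by (rule order_trans[OF S mult_right_mono]) auto
    also have "norm (T x) \<le> (\<bar>KT\<bar> + 1) * norm x"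
      by (rule order_trans[OF T mult_right_mono]) auto
    finally show ?thesis by (simp add: K_def mult_left_mono mult.assoc)
  qed
  moreover have "adjoint_pair (\<lambda>x. S (T x)) (\<lambda>x. S (T x))"
    using adjoint_pair_comp[OF adjoint_pair_sym[OF TS] TS] .
  ultimately have W: "seminorm (S (T x)) \<le> K * seminorm x" for x
    using self_adjoint_seminorm_le_norm_bound[of "\<lambda>x. S (T x)" L K] dom K by blast
  have "seminorm (T x) \<le> sqrt K * seminorm x" for x
  proof (rule power2_le_imp_le)
    have "(seminorm (T x))\<^sup>2 = Re (B x (S (T x)))"
      using TS by (simp add: seminorm_sq adjoint_pair_def)
    also have "\<dots> \<le> seminorm x * seminorm (S (T x))"
      using Cauchy_Schwarz complex_Re_le_cmod order_trans by blast
    also have "\<dots> \<le> seminorm x * (K * seminorm x)" using W by (intro mult_left_mono) auto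
    finally show "(seminorm (T x))\<^sup>2 \<le> (sqrt K * seminorm x)\<^sup>2"
      using K by (simp add: power_mult_distrib) (simp add: power2_eq_square algebra_simps)
  qed (use K in simp)
  then show thesis by (rule that)
qed

section \<open>The fourth-power estimate for vectors\<close>

text \<open>
  Let \<open>Z = e T1 + cnj e S2\<close>. Its adjoint \<open>Z*\<close> satisfies \<open>Z* Z = P + Q\<close>, where
  \<open>Q = 2 Re (e\<^sup>2 T2 T1)\<close> is the symmetric part of the mixed terms. By Cauchy--Schwarz the
  fourth power of the seminorm of \<open>Z y\<close> is at most the product of the squared seminorms of
  \<open>(P + Q) y\<close> and \<open>y\<close>. In the expansion of the first factor the terms
  \<open>P y\<close> and \<open>Q y\<close> yield \<open>p\<^sup>2\<close> and \<open>(2 w)\<^sup>2\<close>, and the mixed term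
  \<open>2 Re (B (P y) (Q y))\<close> is twice the real part of
  \<open>e\<^sup>2\<close> times the quadratic form of \<open>P T2 T1 + T2 T1 P\<close>.
\<close>

lemma rotated_sum_estimate:
  assumes P_def: "P = (\<lambda>x. S1 (T1 x) + T2 (S2 x))"
    and adj: "adjoint_pair T1 S1" "adjoint_pair T2 S2"
    and e: "cmod e = 1"
    and p: "\<And>u. seminorm (P u) \<le> p * seminorm u"
    and w: "\<And>u. cmod (B (T2 (T1 u)) u) \<le> w * (seminorm u)\<^sup>2"
    and v: "\<And>u. cmod (B (P (T2 (T1 u)) + T2 (T1 (P u))) u) \<le> v * (seminorm u)\<^sup>2"
  shows "seminorm (scaleC e (T1 y) + scaleC (cnj e) (S2 y)) ^ 4
    \<le> (p\<^sup>2 + 4 * w\<^sup>2 + 2 * v) * seminorm y ^ 4"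
proof -
  define Q where "Q u = scaleC (e\<^sup>2) (T2 (T1 u)) + scaleC (cnj (e\<^sup>2)) (S1 (S2 u))" for u
  let ?n = "seminorm y"
  have RR: "adjoint_pair (\<lambda>u. T2 (T1 u)) (\<lambda>u. S1 (S2 u))"
    by (rule adjoint_pair_comp[OF adj(2,1)])
  have P: "adjoint_pair P P"
    unfolding P_def
    by (rule adjoint_pair_add[OF adjoint_pair_comp[OF adjoint_pair_sym[OF adj(1)] adj(1)]
          adjoint_pair_comp[OF adj(2) adjoint_pair_sym[OF adj(2)]]])
  have ee: "cmod (e\<^sup>2) = 1" using e by (simp add: norm_power)
  have eq1: "cnj e * e = 1" "e * cnj e = 1"
    using e complex_norm_square[of e] by (simp_all add: mult.commute)

  have Q: "adjoint_pair Q Q"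
    using adjoint_pair_add[OF adjoint_pair_scale[OF RR, of "e\<^sup>2"]
        adjoint_pair_scale[OF adjoint_pair_sym[OF RR], of "cnj (e\<^sup>2)"]]
    by (simp add: Q_def[abs_def] add.commute)
  have Qform: "cmod (B (Q u) u) \<le> (2 * w) * (seminorm u)\<^sup>2" for u
  proof -
    have "B (S1 (S2 u)) u = cnj (B (T2 (T1 u)) u)"
      using adjoint_pairD[OF RR, of u u] commute by metis
    then have "cmod (B (Q u) u) \<le> cmod (e\<^sup>2 * B (T2 (T1 u)) u) + cmod (cnj (e\<^sup>2) * cnj (B (T2 (T1 u)) u))"
      by (simp add: Q_def form_simps norm_triangle_ineq)
    also have "\<dots> = 2 * cmod (B (T2 (T1 u)) u)"
      using ee by (simp add: norm_mult flip: complex_cnj_power)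
    finally show ?thesis using w[of u] by simp
  qed
  have Qy: "seminorm (Q y) \<le> 2 * w * ?n"
    by (rule self_adjoint_seminorm_le[OF Q Qform])

  have cross: "2 * Re (B (P y) (Q y)) \<le> 2 * v * ?n\<^sup>2"
  proof -
    have 1: "B (P y) (T2 (T1 y)) = cnj (B (P (T2 (T1 y))) y)"
      using adjoint_pairD[OF P, of "T2 (T1 y)" y] commute by metis
    have 2: "B (P y) (S1 (S2 y)) = B (T2 (T1 (P y))) y"
      using adjoint_pairD[OF RR, of "P y" y] by simp
    have "B (P y) (Q y) = cnj (e\<^sup>2 * B (P (T2 (T1 y))) y) + e\<^sup>2 * B (T2 (T1 (P y))) y"
      by (simp add: Q_def form_simps 1 2)
    then have "Re (B (P y) (Q y)) = Re (e\<^sup>2 * B (P (T2 (T1 y)) + T2 (T1 (P y))) y)"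
      by (simp add: form_simps distrib_left cnj.sel del: complex_cnj_power complex_cnj_mult)
    also have "\<dots> \<le> cmod (e\<^sup>2 * B (P (T2 (T1 y)) + T2 (T1 (P y))) y)"
      by (rule complex_Re_le_cmod)
    also have "\<dots> = cmod (B (P (T2 (T1 y)) + T2 (T1 (P y))) y)"
      using ee by (simp add: norm_mult)
    finally show ?thesis using v[of y] by simp
  qed

  let ?z = "scaleC e (T1 y) + scaleC (cnj e) (S2 y)"
  have "(seminorm ?z)\<^sup>2 = Re (B (P y + Q y) y)"
  proof -
    have a: "B (T1 y) (T1 y) = B (S1 (T1 y)) y"
      using adjoint_pairD[OF adjoint_pair_sym[OF adj(1)], of "T1 y" y] by simp
    have b: "B (S2 y) (S2 y) = B (T2 (S2 y)) y"
      using adjoint_pairD[OF adj(2), of "S2 y" y] by simp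
    have c: "B (T1 y) (S2 y) = B (T2 (T1 y)) y"
      using adjoint_pairD[OF adj(2), of "T1 y" y] by simp
    have d: "B (S2 y) (T1 y) = B (S1 (S2 y)) y"
      using adjoint_pairD[OF adjoint_pair_sym[OF adj(1)], of "S2 y" y] by simp
    have "B ?z ?z = (e * cnj e) * B (T1 y) (T1 y) + (cnj e * e) * B (S2 y) (S2 y)
        + e\<^sup>2 * B (T1 y) (S2 y) + cnj (e\<^sup>2) * B (S2 y) (T1 y)"
      by (simp add: form_simps algebra_simps power2_eq_square)
    also have "\<dots> = B (P y + Q y) y"
      unfolding a b c d eq1 by (simp add: P_def Q_def form_simps)
    finally show ?thesis by (simp add: seminorm_sq)
  qed
  also have "\<dots> \<le> seminorm (P y + Q y) * ?n"
    using Cauchy_Schwarz complex_Re_le_cmod order_trans by blast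
  finally have "((seminorm ?z)\<^sup>2)\<^sup>2 \<le> (seminorm (P y + Q y) * ?n)\<^sup>2"
    by (rule power_mono) simp
  also have "\<dots> = ((seminorm (P y))\<^sup>2 + (seminorm (Q y))\<^sup>2 + 2 * Re (B (P y) (Q y))) * ?n\<^sup>2"
    by (simp add: power_mult_distrib seminorm_sq_add)
  also have "\<dots> \<le> ((p * ?n)\<^sup>2 + (2 * w * ?n)\<^sup>2 + 2 * v * ?n\<^sup>2) * ?n\<^sup>2"
    using power_mono[OF p[of y], of 2] power_mono[OF Qy, of 2] cross
    by (intro mult_right_mono add_mono) auto
  also have "\<dots> = (p\<^sup>2 + 4 * w\<^sup>2 + 2 * v) * ?n ^ 4"
    by (simp add: power2_eq_square power4_eq_xxxx algebra_simps)
  finally show ?thesis by (simp flip: power_mult)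
qed

text \<open>
  Choosing the phase \<open>e\<close> that makes \<open>e * (B (T1 y) x + B (T2 x) y)\<close> nonnegative replaces it by
  the real part of \<open>B (Z y) x\<close> for the rotated sum \<open>Z\<close> above: conjugating the second summand turns
  the factor \<open>e\<close> into \<open>cnj e\<close> and \<open>T2\<close> into \<open>S2\<close>. The constant 16 is the square of 4, which comes from
  \<open>(seminorm x)\<^sup>2 * (seminorm y)\<^sup>2 \<le> 1 / 4\<close>.
\<close>

lemma off_diagonal_form_estimate:
  assumes P_def: "P = (\<lambda>x. S1 (T1 x) + T2 (S2 x))"
    and adj: "adjoint_pair T1 S1" "adjoint_pair T2 S2"
    and p: "\<And>u. seminorm (P u) \<le> p * seminorm u"
    and w: "\<And>u. cmod (B (T2 (T1 u)) u) \<le> w * (seminorm u)\<^sup>2"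
    and v: "\<And>u. cmod (B (P (T2 (T1 u)) + T2 (T1 (P u))) u) \<le> v * (seminorm u)\<^sup>2"
    and unit: "(seminorm x)\<^sup>2 + (seminorm y)\<^sup>2 = 1"
    and v0: "0 \<le> v"
  shows "cmod (B (T1 y) x + B (T2 x) y) ^ 4 \<le> (p\<^sup>2 + 4 * w\<^sup>2 + 2 * v) / 16"
proof -
  define c where "c = B (T1 y) x + B (T2 x) y"
  obtain e where e: "cmod e = 1" "e * c = of_real (cmod c)"
  proof (cases "c = 0")
    case True
    then show thesis using that[of 1] by simp
  next
    case False
    then have "cnj c / of_real (cmod c) * c = of_real (cmod c)"
      using complex_norm_square[of c] by (simp add: field_simps power2_eq_square)
    then show thesis using that[of "cnj c / of_real (cmod c)"] False by (simp add: norm_divide)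
  qed
  let ?z = "scaleC e (T1 y) + scaleC (cnj e) (S2 y)"
  have "B (T2 x) y = cnj (B (S2 y) x)"
    using adjoint_pairD[OF adj(2), of x y] commute by metis
  then have "Re (e * c) = Re (B ?z x)"
    by (simp add: c_def form_simps distrib_left)
  then have "cmod c = Re (B ?z x)" using e(2) by simp
  also have "\<dots> \<le> seminorm ?z * seminorm x"
    using Cauchy_Schwarz complex_Re_le_cmod order_trans by blast
  finally have "cmod c ^ 4 \<le> (seminorm ?z * seminorm x) ^ 4"
    by (rule power_mono) simp
  also have "\<dots> = seminorm ?z ^ 4 * seminorm x ^ 4" by (rule power_mult_distrib)
  also have "\<dots> \<le> (p\<^sup>2 + 4 * w\<^sup>2 + 2 * v) * seminorm y ^ 4 * seminorm x ^ 4"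
    using rotated_sum_estimate[OF P_def adj e(1) p w v, of y]
    by (intro mult_right_mono) auto
  also have "\<dots> = (p\<^sup>2 + 4 * w\<^sup>2 + 2 * v) * ((seminorm x)\<^sup>2 * (seminorm y)\<^sup>2)\<^sup>2"
    by (simp add: power_mult_distrib algebra_simps flip: power_mult)
  also have "\<dots> \<le> (p\<^sup>2 + 4 * w\<^sup>2 + 2 * v) * (1 / 4)\<^sup>2"
  proof (intro mult_left_mono power_mono)
    have "0 \<le> ((seminorm x)\<^sup>2 - (seminorm y)\<^sup>2)\<^sup>2" by simp
    also have "\<dots> = ((seminorm x)\<^sup>2 + (seminorm y)\<^sup>2)\<^sup>2 - 4 * ((seminorm x)\<^sup>2 * (seminorm y)\<^sup>2)"
      by (simp add: power2_eq_square algebra_simps)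
    finally show "(seminorm x)\<^sup>2 * (seminorm y)\<^sup>2 \<le> 1 / 4" by (simp add: unit)
  qed (use v0 in auto)
  finally show ?thesis by (simp add: c_def power2_eq_square)
qed

end

section \<open>Hilbert spaces: projection, Riesz representation, adjoints\<close>

interpretation hilbert: positive_form cinner
proof
  fix x :: 'a
  show "0 \<le> Re (cinner x x)"
    using cinner_self_nonneg[of x] by (simp add: complex_nonneg_Reals_iff)
qed (rule cinner_add_left cinner_scaleC_left cinner_commute)+

lemma hilbert_seminorm [simp]: "hilbert.seminorm = norm"
  by (simp add: fun_eq_iff hilbert.seminorm_def norm_eq_sqrt_cinner)

lemmas norm_scaleC = hilbert.seminorm_scale[unfolded hilbert_seminorm]
  and norm_cinner_le = hilbert.Cauchy_Schwarz[unfolded hilbert_seminorm]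
  and norm_sq_eq_cinner = hilbert.seminorm_sq[unfolded hilbert_seminorm]

lemma scaleC_scaleR: "scaleC c (scaleR r x) = scaleR r (scaleC c (x::'a::complex_inner))"
  by (simp add: scaleC_of_real[symmetric] scaleC_scaleC mult.commute)

lemma bounded_linear_scaleC: "bounded_linear (\<lambda>x::'a::complex_inner. scaleC c x)"
  by (rule bounded_linear_intro[of _ "cmod c"])
    (auto simp: scaleC_add_right scaleC_scaleR norm_scaleC)

lemma bounded_linear_cinner_left: "bounded_linear (\<lambda>x::'a::complex_inner. cinner x y)"
proof (rule bounded_linear_intro[of _ "norm y"])
  fix r and x :: 'a
  show "cinner (scaleR r x) y = scaleR r (cinner x y)"
    by (metis scaleC_of_real cinner_scaleC_left scaleR_conv_of_real)
qed (auto simp: cinner_add_left norm_cinner_le)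

lemma bounded_linear_cinner_right: "bounded_linear (\<lambda>y::'a::complex_inner. cinner x y)"
proof -
  have "(\<lambda>y. cinner x y) = (\<lambda>y. cnj (cinner y x))"
    using cinner_commute by blast
  then show ?thesis
    using bounded_linear_compose[OF bounded_linear_cnj bounded_linear_cinner_left[of x]] by simp
qed

lemma eq_zero_if_orthogonal_to_all:
  assumes "\<And>y. cinner y x = 0" shows "(x::'a::complex_inner) = 0"
  using assms[of x] by (simp add: cinner_self_eq_0_iff)

definition complex_subspace :: "'a::complex_inner set \<Rightarrow> bool" where
  "complex_subspace M \<longleftrightarrow>
    0 \<in> M \<and> (\<forall>x\<in>M. \<forall>y\<in>M. x + y \<in> M) \<and> (\<forall>c. \<forall>x\<in>M. scaleC c x \<in> M)"

lemma complex_subspace_diff: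
  "complex_subspace M \<Longrightarrow> x \<in> M \<Longrightarrow> y \<in> M \<Longrightarrow> x - y \<in> M"
  unfolding complex_subspace_def by (metis scaleC_minus_one diff_conv_add_uminus)

lemma complex_subspace_closure:
  assumes "complex_subspace M" shows "complex_subspace (closure M)"
  unfolding complex_subspace_def
proof (intro conjI ballI allI)
  show "0 \<in> closure M"
    using assms closure_subset by (auto simp: complex_subspace_def)
next
  fix x y assume "x \<in> closure M" "y \<in> closure M"
  then obtain f g where "\<And>n. f n \<in> M" "f \<longlonglongrightarrow> x" "\<And>n. g n \<in> M" "g \<longlonglongrightarrow> y"
    unfolding closure_sequential by auto
  then show "x + y \<in> closure M"
    using assms unfolding closure_sequential
    by (intro exI[of _ "\<lambda>n. f n + g n"]) (auto simp: complex_subspace_def intro: tendsto_add)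
next
  fix c x assume "x \<in> closure M"
  then obtain f where "\<And>n. f n \<in> M" "f \<longlonglongrightarrow> x"
    unfolding closure_sequential by auto
  then show "scaleC c x \<in> closure M"
    using assms bounded_linear.tendsto[OF bounded_linear_scaleC] unfolding closure_sequential
    by (intro exI[of _ "\<lambda>n. scaleC c (f n)"]) (auto simp: complex_subspace_def)
qed

text \<open>
  The point \<open>p\<close> is the nearest point of \<open>M\<close>. By the parallelogram law a minimizing sequence is
  Cauchy, because the midpoint of two of its members is again in \<open>M\<close>, so that its distance from \<open>x\<close>
  cannot fall below the infimum.
\<close>

lemma orthogonal_decomposition:
  fixes M :: "'a::complex_hilbert set"
  assumes M: "complex_subspace M" and "closed M"
  obtains p where "p \<in> M" "\<And>m. m \<in> M \<Longrightarrow> cinner (x - p) m = 0"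
proof -
  define D where "D = (\<lambda>m. (norm (x - m))\<^sup>2) ` M"
  define d where "d = Inf D"
  have "D \<noteq> {}" using M by (auto simp: D_def complex_subspace_def)
  have bdd: "bdd_below D" by (intro bdd_belowI[of _ 0]) (auto simp: D_def)
  have lower: "d \<le> (norm (x - m))\<^sup>2" if "m \<in> M" for m
    unfolding d_def using that by (intro cInf_lower bdd) (auto simp: D_def)
  have "\<exists>m\<in>M. (norm (x - m))\<^sup>2 < d + 1 / real (Suc n)" for n
  proof -
    have "Inf D < d + 1 / real (Suc n)" by (simp add: d_def)
    then show ?thesis
      using cInf_lessD[OF \<open>D \<noteq> {}\<close>, of "d + 1 / real (Suc n)"] by (auto simp: D_def)
  qed
  then obtain f where f: "\<And>n. f n \<in> M" "\<And>n. (norm (x - f n))\<^sup>2 < d + 1 / real (Suc n)"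
    by metis
  have gap: "(norm (f m - f n))\<^sup>2 \<le> 2 / real (Suc m) + 2 / real (Suc n)" for m n
  proof -
    define h where "h = scaleC (of_real (1/2)) (f m + f n)"
    have h: "h \<in> M" using M f(1) by (simp add: h_def complex_subspace_def)
    have "(x - f m) + (x - f n) = scaleR 2 (x - h)"
      using scaleC_of_real[of "1/2" "f m + f n"] by (simp add: h_def scaleR_diff_right scaleR_2)
    then have "(norm ((x - f m) + (x - f n)))\<^sup>2 = 4 * (norm (x - h))\<^sup>2"
      by (simp add: power_mult_distrib)
    moreover have "norm ((x - f m) - (x - f n)) = norm (f m - f n)"
      by (simp add: norm_minus_commute)
    ultimately have "4 * (norm (x - h))\<^sup>2 + (norm (f m - f n))\<^sup>2
        = 2 * (norm (x - f m))\<^sup>2 + 2 * (norm (x - f n))\<^sup>2"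
      using hilbert.parallelogram[of "x - f m" "x - f n", unfolded hilbert_seminorm] by simp
    then show ?thesis using lower[OF h] f(2)[of m] f(2)[of n] by simp
  qed
  have "Cauchy f"
  proof (rule metric_CauchyI)
    fix e :: real assume e: "0 < e"
    obtain N where N: "4 / e\<^sup>2 < real (Suc N)"
      using reals_Archimedean2[of "4 / e\<^sup>2"] by (metis less_trans lessI of_nat_less_iff)
    have "dist (f m) (f n) < e" if "N \<le> m" "N \<le> n" for m n
    proof -
      have "2 / real (Suc m) \<le> 2 / real (Suc N)" "2 / real (Suc n) \<le> 2 / real (Suc N)"
        using that by (auto intro!: divide_left_mono)
      then have "(norm (f m - f n))\<^sup>2 \<le> 4 / real (Suc N)" using gap[of m n] by simp
      also have "\<dots> < e\<^sup>2" using N e by (simp add: field_simps)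
      finally show ?thesis using e by (simp add: dist_norm power_less_imp_less_base)
    qed
    then show "\<exists>N. \<forall>m\<ge>N. \<forall>n\<ge>N. dist (f m) (f n) < e" by blast
  qed
  then obtain p where p: "f \<longlonglongrightarrow> p" using Cauchy_convergent convergent_def by blast
  then have "p \<in> M" using \<open>closed M\<close> f(1) closed_sequentially by blast
  have "(norm (x - p))\<^sup>2 \<le> d"
  proof (rule LIMSEQ_le)
    show "(\<lambda>n. (norm (x - f n))\<^sup>2) \<longlonglongrightarrow> (norm (x - p))\<^sup>2" by (intro tendsto_intros p)
    show "(\<lambda>n. d + 1 / real (Suc n)) \<longlonglongrightarrow> d"
      using tendsto_add[OF tendsto_const LIMSEQ_inverse_real_of_nat, of d] by (simp add: inverse_eq_divide)
    show "\<exists>N. \<forall>n\<ge>N. (norm (x - f n))\<^sup>2 \<le> d + 1 / real (Suc n)" using f(2) less_imp_le by blast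
  qed
  have "cinner (x - p) m = 0" if m: "m \<in> M" for m
  proof (rule hilbert.orthogonal_if_no_descent, unfold hilbert_seminorm)
    fix t
    let ?c = "of_real t * cinner (x - p) m"
    have "p + scaleC ?c m \<in> M" using M m \<open>p \<in> M\<close> by (simp add: complex_subspace_def)
    from lower[OF this] \<open>(norm (x - p))\<^sup>2 \<le> d\<close>
    show "(norm (x - p))\<^sup>2 \<le> (norm (x - p - scaleC ?c m))\<^sup>2"
      unfolding diff_diff_eq by (rule order_trans[rotated])
  qed
  with \<open>p \<in> M\<close> show thesis by (rule that)
qed

lemma bounded_operatorsD:
  assumes "T \<in> bounded_operators"
  shows "bounded_linear T" "T (scaleC c x) = scaleC c (T x)" "T (x + y) = T x + T y"
    "T (x - y) = T x - T y" "T 0 = 0"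
proof -
  show lin: "bounded_linear T" and "T (scaleC c x) = scaleC c (T x)"
    using assms by (simp_all add: bounded_operators_def)
  show "T (x + y) = T x + T y" "T (x - y) = T x - T y" "T 0 = 0"
    using linear_simps[OF lin] by blast+
qed

lemma bounded_operatorsI:
  assumes "\<And>x y. T (x + y) = T x + T y" "\<And>c x. T (scaleC c x) = scaleC c (T x)"
    "\<And>x. norm (T x) \<le> K * norm x"
  shows "T \<in> bounded_operators"
proof -
  have "T (scaleR r x) = scaleR r (T x)" for r x
    using assms(2)[of "of_real r" x] by (simp add: scaleC_of_real)
  then have "bounded_linear T"
    using assms by (intro bounded_linear_intro[of T K]) (simp_all add: mult.commute)
  then show ?thesis using assms(2) by (simp add: bounded_operators_def)
qed

lemma bounded_operators_bound:
  assumes "T \<in> bounded_operators" obtains K where "0 < K" "\<And>x. norm (T x) \<le> K * norm x"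
  using bounded_linear.pos_bounded[OF bounded_operatorsD(1)[OF assms]]
  by (metis mult.commute)

lemma bounded_operators_comp:
  assumes "S \<in> bounded_operators" "T \<in> bounded_operators"
  shows "(\<lambda>x. S (T x)) \<in> bounded_operators"
  using assms bounded_linear_compose[of S T] by (simp add: bounded_operators_def)

lemma bounded_operators_add:
  assumes "S \<in> bounded_operators" "T \<in> bounded_operators"
  shows "(\<lambda>x. S x + T x) \<in> bounded_operators"
  using assms bounded_linear_add[of S T] by (simp add: bounded_operators_def scaleC_add_right)

text \<open>
  If \<open>f\<close> is nonzero, its kernel has a nonzero orthogonal vector \<open>q\<close>, and the representing vector is
  a multiple of \<open>q\<close>, as every \<open>x\<close> differs from \<open>(f x / f q) q\<close> by an element of the kernel.
\<close>

lemma Riesz_representation: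
  fixes f :: "'a::complex_hilbert \<Rightarrow> complex"
  assumes f: "bounded_linear f" and scale: "\<And>c x. f (scaleC c x) = c * f x"
  obtains z where "\<And>x. f x = cinner x z"
proof (cases "\<forall>x. f x = 0")
  case True
  have "cinner x 0 = 0" for x :: 'a using hilbert.diff_right[of x 0 0] by simp
  with True show thesis by (intro that[of 0]) simp
next
  case False
  then obtain u where u: "f u \<noteq> 0" by blast
  let ?M = "{x. f x = 0}"
  have "complex_subspace ?M"
    using scale linear_simps(1,3)[OF f] by (simp add: complex_subspace_def)
  moreover have "closed ?M"
    by (intro closed_Collect_eq continuous_intros linear_continuous_on f)
  ultimately obtain p where p: "f p = 0" "\<And>m. f m = 0 \<Longrightarrow> cinner (u - p) m = 0"
    using orthogonal_decomposition[of ?M u] by auto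
  define q where "q = u - p"
  have fq: "f q \<noteq> 0" using u p by (simp add: q_def linear_simps[OF f])
  then have "q \<noteq> 0" using linear_simps(3)[OF f] by auto
  then have qq: "cinner q q \<noteq> 0" by (simp add: cinner_self_eq_0_iff)
  show thesis
  proof (rule that[of "scaleC (cnj (f q / cinner q q)) q"])
    fix x
    have "f (x - scaleC (f x / f q) q) = 0" using fq by (simp add: linear_simps[OF f] scale)
    then have "cinner q (x - scaleC (f x / f q) q) = 0" using p(2) by (simp add: q_def)
    then have "cinner (x - scaleC (f x / f q) q) q = 0"
      using cinner_commute[of "x - scaleC (f x / f q) q" q] by simp
    then have "cinner x q = f x / f q * cinner q q" by (simp add: hilbert.form_simps)
    then show "f x = cinner x (scaleC (cnj (f q / cinner q q)) q)"
      using fq qq by (simp add: hilbert.form_simps)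
  qed
qed

text \<open>
  The Riesz representation, applied to \<open>\<lambda>x. cinner (T x) y\<close>, shows that the definite description
  defining the adjoint is satisfied by exactly one operator.
\<close>

lemma hilbert_adjoint:
  fixes T :: "'a::complex_hilbert \<Rightarrow> 'a"
  assumes T: "T \<in> bounded_operators"
  shows "hilbert_adjoint T \<in> bounded_operators"
    and "cinner (T x) y = cinner x (hilbert_adjoint T y)"
proof -
  have "\<exists>z. \<forall>x. cinner (T x) y = cinner x z" for y
  proof (rule Riesz_representation[of "\<lambda>x. cinner (T x) y"])
    show "bounded_linear (\<lambda>x. cinner (T x) y)"
      by (rule bounded_linear_compose[OF bounded_linear_cinner_left bounded_operatorsD(1)[OF T]])
  qed (auto simp: bounded_operatorsD(2)[OF T] cinner_scaleC_left)
  then obtain S where S: "\<And>x y. cinner (T x) y = cinner x (S y)" by metis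
  have unique: "u = v" if "\<And>x. cinner x u = cinner x v" for u v :: 'a
    using eq_zero_if_orthogonal_to_all[of "u - v"] that by (simp add: hilbert.diff_right)
  obtain K where K: "0 < K" "\<And>x. norm (T x) \<le> K * norm x"
    by (rule bounded_operators_bound[OF T]) blast
  have "S \<in> bounded_operators"
  proof (rule bounded_operatorsI)
    show "S (x + y) = S x + S y" for x y
      by (rule unique) (simp add: hilbert.add_right S[symmetric])
    show "S (scaleC c x) = scaleC c (S x)" for c x
      by (rule unique) (simp add: hilbert.scale_right S[symmetric])
    show "norm (S x) \<le> K * norm x" for x
    proof (cases "S x = 0")
      case False
      have "(norm (S x))\<^sup>2 = Re (cinner (T (S x)) x)" by (simp add: norm_sq_eq_cinner S)
      also have "\<dots> \<le> norm (T (S x)) * norm x"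
        using norm_cinner_le complex_Re_le_cmod order_trans by blast
      also have "\<dots> \<le> K * norm (S x) * norm x" by (intro mult_right_mono K) simp
      finally have "norm (S x) * norm (S x) \<le> norm (S x) * (K * norm x)"
        by (simp add: power2_eq_square mult_ac)
      then show ?thesis using False by simp
    qed (use K in simp)
  qed
  then have "\<exists>!S. S \<in> bounded_operators \<and> (\<forall>x y. cinner (T x) y = cinner x (S y))"
    using S by (intro ex1I[of _ S]) (auto intro!: unique)
  then have "hilbert_adjoint T \<in> bounded_operators \<and>
      (\<forall>x y. cinner (T x) y = cinner x (hilbert_adjoint T y))"
    unfolding hilbert_adjoint_def by (rule theI')
  then show "hilbert_adjoint T \<in> bounded_operators"
    and "cinner (T x) y = cinner x (hilbert_adjoint T y)" by auto
qed

section \<open>Positive operators and the distinguished adjoint\<close>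

lemma positive_operatorD:
  fixes A :: "'a::complex_hilbert \<Rightarrow> 'a"
  assumes "positive_operator A"
  shows "A \<in> bounded_operators" "cinner (A x) y = cinner x (A y)" "0 \<le> Re (cinner (A x) x)"
  using assms hilbert_adjoint(2)[of A x y]
  by (auto simp: positive_operator_def complex_nonneg_Reals_iff)

lemma positive_form_A_inner:
  fixes A :: "'a::complex_hilbert \<Rightarrow> 'a"
  assumes A: "positive_operator A" shows "positive_form (A_inner A)"
proof
  fix x y z :: 'a and c
  note [simp] = bounded_operatorsD[OF positive_operatorD(1)[OF A]]
  show "A_inner A (x + y) z = A_inner A x z + A_inner A y z"
    by (simp add: A_inner_def cinner_add_left)
  show "A_inner A (scaleC c x) y = c * A_inner A x y"
    by (simp add: A_inner_def cinner_scaleC_left)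
  show "A_inner A x y = cnj (A_inner A y x)"
    unfolding A_inner_def using positive_operatorD(2)[OF A, of x y] cinner_commute by metis
  show "0 \<le> Re (A_inner A x x)"
    by (simp add: A_inner_def positive_operatorD(3)[OF A])
qed

lemma seminorm_A_inner:
  fixes A :: "'a::complex_hilbert \<Rightarrow> 'a"
  assumes "positive_operator A" shows "positive_form.seminorm (A_inner A) = A_norm A"
  by (simp add: fun_eq_iff A_norm_def positive_form.seminorm_def positive_form_A_inner assms)

lemma complex_subspace_range:
  assumes "T \<in> bounded_operators" shows "complex_subspace (range T)"
  unfolding complex_subspace_def
proof (intro conjI ballI allI)
  show "0 \<in> range T" using bounded_operatorsD(5)[OF assms] by (metis rangeI)
  show "x + y \<in> range T" if "x \<in> range T" "y \<in> range T" for x y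
    using that by (auto simp flip: bounded_operatorsD(3)[OF assms])
  show "scaleC c x \<in> range T" if "x \<in> range T" for c x
    using that by (auto simp flip: bounded_operatorsD(2)[OF assms])
qed

text \<open>
  The space is the direct sum of \<open>closure (range A)\<close> and the kernel of \<open>A\<close>. This gives existence
  and uniqueness of the values of \<open>A_adjoint A T\<close>, and it reduces seminorm bounds on the
  whole space to vectors in \<open>closure (range A)\<close>.
\<close>

lemma kernel_inter_closure_range:
  fixes A :: "'a::complex_hilbert \<Rightarrow> 'a"
  assumes A: "positive_operator A" and "A x = 0" and x: "x \<in> closure (range A)"
  shows "x = 0"
proof -
  have "closed {v. cinner x v = 0}"
    by (intro closed_Collect_eq continuous_intros linear_continuous_on bounded_linear_cinner_right)
  moreover have "range A \<subseteq> {v. cinner x v = 0}"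
    using \<open>A x = 0\<close> hilbert.diff_left[of 0 0] by (auto simp flip: positive_operatorD(2)[OF A])
  ultimately have "closure (range A) \<subseteq> {v. cinner x v = 0}" by (rule closure_minimal[rotated])
  with x show ?thesis by (auto simp: cinner_self_eq_0_iff)
qed

lemma kernel_closure_range_decomposition:
  fixes A :: "'a::complex_hilbert \<Rightarrow> 'a"
  assumes A: "positive_operator A"
  obtains p where "p \<in> closure (range A)" "A (x - p) = 0"
proof -
  have "complex_subspace (closure (range A))"
    by (intro complex_subspace_closure complex_subspace_range positive_operatorD A)
  then obtain p where p: "p \<in> closure (range A)"
      "\<And>m. m \<in> closure (range A) \<Longrightarrow> cinner (x - p) m = 0"
    using orthogonal_decomposition[of "closure (range A)" x] by auto
  have "cinner (x - p) (A (A (x - p))) = 0"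
    using p(2) closure_subset by (meson rangeI subsetD)
  then have "cinner (A (x - p)) (A (x - p)) = 0"
    using positive_operatorD(2)[OF A, of "x - p"] by simp
  then show thesis using p(1) that by (simp add: cinner_self_eq_0_iff)
qed

text \<open>
  A uniform boundedness principle, in place of the closed graph theorem. The set \<open>E n\<close> of all \<open>x\<close>
  with \<open>norm (X x) \<le> n\<close> is closed although \<open>X\<close> is not known to be continuous: since \<open>X x\<close> lies in
  the closure of \<open>V\<close>, its norm is determined by the pairings with \<open>V\<close>, and these depend
  continuously on \<open>x\<close>. By Baire's theorem some \<open>E n\<close> contains a ball, which bounds \<open>X\<close>.
\<close>

lemma uniform_boundedness_cinner:
  fixes X :: "'a::complex_hilbert \<Rightarrow> 'b::complex_inner"
  assumes add: "\<And>x y. X (x + y) = X x + X y" and scale: "\<And>c x. X (scaleC c x) = scaleC c (X x)"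
    and cont: "\<And>v. v \<in> V \<Longrightarrow> continuous_on UNIV (\<lambda>x. cinner (X x) v)"
    and X: "\<And>x. X x \<in> closure V"
  obtains K where "\<And>x. norm (X x) \<le> K * norm x"
proof -
  define E where "E n = (\<Inter>v\<in>V. {x. cmod (cinner (X x) v) \<le> real n * norm v})" for n
  have closed_E: "closed (E n)" for n
    unfolding E_def
    by (intro closed_INT ballI closed_Collect_le continuous_on_norm cont continuous_on_const)
  have E_iff: "x \<in> E n \<longleftrightarrow> norm (X x) \<le> real n" for x n
  proof
    assume "norm (X x) \<le> real n"
    then show "x \<in> E n"
      unfolding E_def using norm_cinner_le order_trans mult_right_mono[OF _ norm_ge_zero] by blast
  next
    assume x: "x \<in> E n"
    have "closed {v. cmod (cinner (X x) v) \<le> real n * norm v}"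
      by (intro closed_Collect_le continuous_intros linear_continuous_on bounded_linear_cinner_right)
    moreover have "V \<subseteq> {v. cmod (cinner (X x) v) \<le> real n * norm v}"
      using x by (auto simp: E_def)
    \<comment> \<open>Passing to the closure makes \<open>v = X x\<close> admissible.\<close>
    ultimately have "closure V \<subseteq> {v. cmod (cinner (X x) v) \<le> real n * norm v}"
      by (rule closure_minimal[rotated])
    then have "cmod (cinner (X x) (X x)) \<le> real n * norm (X x)" using X by blast
    moreover have "cmod (cinner (X x) (X x)) = (norm (X x))\<^sup>2"
      by (subst hilbert.self_real) (simp add: norm_sq_eq_cinner[symmetric] norm_power)
    ultimately show "norm (X x) \<le> real n"
      by (cases "X x = 0") (auto simp: power2_eq_square)
  qed
  have "\<exists>n. interior (E n) \<noteq> {}"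
  proof (rule ccontr)
    assume none: "\<not> ?thesis"
    have "euclidean interior_of \<Union> (range E) = {}"
    proof (rule Baire_category_alt)
      show "completely_metrizable_space (euclidean :: 'a topology) \<or>
          locally_compact_space (euclidean :: 'a topology) \<and> regular_space (euclidean :: 'a topology)"
        by (simp add: completely_metrizable_space_euclidean)
    next
      fix F assume "F \<in> range E"
      then show "closedin euclidean F \<and> euclidean interior_of F = {}"
        using none closed_E by (metis (no_types) closed_closedin euclidean_interior_of imageE)
    qed simp
    moreover have "x \<in> \<Union> (range E)" for x
      using E_iff[of x] real_arch_simple[of "norm (X x)"] by auto
    then have "\<Union> (range E) = UNIV" by blast
    ultimately show False by (metis UNIV_not_empty euclidean_interior_of interior_UNIV)
  qed
  then obtain n z where "z \<in> interior (E n)" by blast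
  then obtain r where r: "0 < r" "ball z r \<subseteq> E n" unfolding mem_interior by blast
  have small: "norm (X h) \<le> 2 * real n" if "norm h < r" for h
  proof -
    have "z + h \<in> E n" "z \<in> E n" using r that by (auto simp: dist_norm subset_iff)
    moreover have "X h = X (z + h) - X z" by (simp add: add)
    ultimately show ?thesis
      using norm_triangle_ineq4[of "X (z + h)" "X z"] by (simp add: E_iff)
  qed
  have Xr: "X (scaleR s x) = scaleR s (X x)" for s x
    using scale[of "of_real s" x] by (simp add: scaleC_of_real)
  show thesis
  proof (rule that)
    fix x
    show "norm (X x) \<le> (4 * real n / r) * norm x"
    proof (cases "x = 0")
      case True
      then show ?thesis using Xr[of 0 0] by simp
    next
      case False
      have "norm (X (scaleR (r / (2 * norm x)) x)) \<le> 2 * real n"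
        using False r by (intro small) simp
      then show ?thesis using False r by (simp add: Xr field_simps)
    qed
  qed
qed

text \<open>
  The range condition on \<open>T\<close> and the decomposition of the space give for each \<open>x\<close> a unique \<open>X x\<close> in
  \<open>closure (range A)\<close> with \<open>A (X x) = hilbert_adjoint T (A x)\<close>. Only the boundedness of \<open>X\<close> needs an
  argument: the pairing of \<open>X x\<close> with \<open>A w\<close> is that of \<open>hilbert_adjoint T (A x)\<close> with \<open>w\<close>, which is
  continuous in \<open>x\<close>, so uniform boundedness applies with \<open>range A\<close> as the set of test vectors.
\<close>

lemma A_adjoint:
  fixes A :: "'a::complex_hilbert \<Rightarrow> 'a"
  assumes A: "positive_operator A" and T: "T \<in> A_adjointable A"
  shows "A_adjoint A T \<in> bounded_operators"
    and "positive_form.adjoint_pair (A_inner A) T (A_adjoint A T)"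
proof -
  note A_op = positive_operatorD(1)[OF A]
  note A_simps = bounded_operatorsD[OF A_op]
  let ?N = "closure (range A)" and ?T = "hilbert_adjoint T"
  have T_op: "T \<in> bounded_operators" and T_range: "\<And>x. ?T (A x) \<in> range A"
    using T by (auto simp: A_adjointable_def)
  note T'_op = hilbert_adjoint(1)[OF T_op]
  have N: "complex_subspace ?N"
    by (intro complex_subspace_closure complex_subspace_range A_op)
  have unique: "u = v" if "u \<in> ?N" "v \<in> ?N" "A u = A v" for u v
    using kernel_inter_closure_range[OF A, of "u - v"] complex_subspace_diff[OF N] that
    by (simp add: A_simps)
  have "\<exists>u\<in>?N. A u = ?T (A x)" for x
  proof -
    obtain v where v: "?T (A x) = A v" using T_range by blast
    obtain u where "u \<in> ?N" "A (v - u) = 0" by (rule kernel_closure_range_decomposition[OF A])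
    then show ?thesis using v by (auto simp: A_simps)
  qed
  then obtain X where X: "\<And>x. X x \<in> ?N" "\<And>x. A (X x) = ?T (A x)" by metis
  have add: "X (x + y) = X x + X y" for x y
  proof (rule unique)
    show "X x + X y \<in> ?N" using N X by (simp add: complex_subspace_def)
  qed (simp_all add: X A_simps bounded_operatorsD[OF T'_op])
  have scale: "X (scaleC c x) = scaleC c (X x)" for c x
  proof (rule unique)
    show "scaleC c (X x) \<in> ?N" using N X by (simp add: complex_subspace_def)
  qed (simp_all add: X A_simps bounded_operatorsD[OF T'_op])
  obtain K where K: "\<And>x. norm (X x) \<le> K * norm x"
  proof (rule uniform_boundedness_cinner[of X "range A"])
    fix v assume "v \<in> range A"
    then obtain w where "v = A w" by blast
    then have "(\<lambda>x. cinner (X x) v) = (\<lambda>x. cinner (?T (A x)) w)"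
      by (simp add: positive_operatorD(2)[OF A, symmetric] X)
    then show "continuous_on UNIV (\<lambda>x. cinner (X x) v)"
      by (simp add: linear_continuous_on bounded_linear_compose[OF bounded_linear_cinner_left
            bounded_operatorsD(1)[OF bounded_operators_comp[OF T'_op A_op]]])
  qed (use add scale X in auto)
  have "X \<in> bounded_operators" by (rule bounded_operatorsI[OF add scale K])
  have "\<exists>!X. X \<in> bounded_operators \<and> A \<circ> X = ?T \<circ> A \<and> range X \<subseteq> ?N"
  proof (rule ex1I[of _ X])
    show "X \<in> bounded_operators \<and> A \<circ> X = ?T \<circ> A \<and> range X \<subseteq> ?N"
      using \<open>X \<in> bounded_operators\<close> X by (auto simp: fun_eq_iff)
  next
    fix Y assume Y: "Y \<in> bounded_operators \<and> A \<circ> Y = ?T \<circ> A \<and> range Y \<subseteq> ?N"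
    show "Y = X"
    proof
      fix x
      have "A (Y x) = ?T (A x)" using Y by (metis comp_apply)
      moreover have "Y x \<in> ?N" using Y by blast
      ultimately show "Y x = X x" using X by (metis unique)
    qed
  qed
  then have "A_adjoint A T \<in> bounded_operators \<and> A \<circ> A_adjoint A T = ?T \<circ> A \<and>
      range (A_adjoint A T) \<subseteq> ?N"
    unfolding A_adjoint_def by (rule theI')
  then have adj: "A_adjoint A T \<in> bounded_operators" "\<And>x. A (A_adjoint A T x) = ?T (A x)"
    by (auto simp: fun_eq_iff)
  show "A_adjoint A T \<in> bounded_operators" by (rule adj)
  show "positive_form.adjoint_pair (A_inner A) T (A_adjoint A T)"
    unfolding positive_form.adjoint_pair_def[OF positive_form_A_inner[OF A]] A_inner_def
    by (simp add: positive_operatorD(2)[OF A] adj(2) hilbert_adjoint(2)[OF T_op])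
qed

section \<open>Suprema defined by the seminorm\<close>

lemma A_norm_le_norm:
  fixes A :: "'a::complex_hilbert \<Rightarrow> 'a"
  assumes A: "positive_operator A"
  obtains L where "\<And>x. A_norm A x \<le> L * norm x"
proof -
  obtain K where K: "0 < K" "\<And>x. norm (A x) \<le> K * norm x"
    by (rule bounded_operators_bound[OF positive_operatorD(1)[OF A]]) blast
  have "A_norm A x \<le> sqrt K * norm x" for x
  proof -
    have "Re (cinner (A x) x) \<le> norm (A x) * norm x"
      using norm_cinner_le complex_Re_le_cmod order_trans by blast
    also have "\<dots> \<le> K * norm x * norm x" by (intro mult_right_mono K) simp
    finally have "sqrt (Re (cinner (A x) x)) \<le> sqrt (K * norm x * norm x)"
      by (rule real_sqrt_le_mono)
    then show ?thesis by (simp add: A_norm_def A_inner_def real_sqrt_mult mult.assoc)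
  qed
  then show thesis by (rule that)
qed

text \<open>
  Boundedness in the norm of the Hilbert space says nothing about boundedness in the
  \<open>A\<close>-seminorm; the existence of a bounded \<open>A\<close>-adjoint is what makes it follow.
\<close>

lemma A_norm_bounded_if_adjoint_pair:
  fixes A :: "'a::complex_hilbert \<Rightarrow> 'a"
  assumes A: "positive_operator A" and T: "T \<in> bounded_operators" and S: "S \<in> bounded_operators"
    and TS: "positive_form.adjoint_pair (A_inner A) T S"
  obtains C where "\<And>x. A_norm A (T x) \<le> C * A_norm A x"
proof -
  interpret positive_form "A_inner A" by (rule positive_form_A_inner[OF A])
  obtain L where L: "\<And>x. A_norm A x \<le> L * norm x"
    by (rule A_norm_le_norm[OF A]) blast
  have dom: "seminorm x \<le> L * norm x" for x
    using L[of x] by (simp add: seminorm_A_inner[OF A])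
  obtain KT where KT: "0 < KT" "\<And>x. norm (T x) \<le> KT * norm x"
    by (rule bounded_operators_bound[OF T]) blast
  obtain KS where KS: "0 < KS" "\<And>x. norm (S x) \<le> KS * norm x"
    by (rule bounded_operators_bound[OF S]) blast
  obtain C where "\<And>x. seminorm (T x) \<le> C * seminorm x"
    by (rule adjoint_pair_seminorm_bounded[OF TS dom KT(2) KS(2)]) blast
  then show thesis by (intro that[of C]) (simp add: seminorm_A_inner[OF A])
qed

text \<open>
  The supremum defining \<open>A_numerical_radius\<close> runs over \<open>A\<close>-unit vectors; homogeneity transfers it
  to all vectors of positive seminorm, and on the vectors of seminorm zero the form vanishes by
  Cauchy--Schwarz. \<open>A\<close>-boundedness of \<open>R\<close> makes the supremum that of a bounded set.
\<close>

lemma cmod_A_inner_le_numerical_radius: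
  fixes A :: "'a::complex_hilbert \<Rightarrow> 'a"
  assumes A: "positive_operator A" and R: "R \<in> bounded_operators"
    and C: "\<And>x. A_norm A (R x) \<le> C * A_norm A x"
  shows "cmod (A_inner A (R u) u) \<le> A_numerical_radius A R * (A_norm A u)\<^sup>2"
proof -
  interpret positive_form "A_inner A" by (rule positive_form_A_inner[OF A])
  note [simp] = seminorm_A_inner[OF A]
  have CS: "cmod (A_inner A x y) \<le> A_norm A x * A_norm A y" for x y
    using Cauchy_Schwarz[of x y] by simp
  have nonneg: "0 \<le> A_norm A x" for x using seminorm_nonneg[of x] by simp
  let ?W = "insert 0 {cmod (A_inner A (R x) x) | x. A_norm A x = 1}"
  have bdd: "bdd_above ?W"
  proof (rule bdd_aboveI[of _ "max 0 C"])
    fix s assume "s \<in> ?W"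
    then consider "s = 0" | x where "A_norm A x = 1" "s = cmod (A_inner A (R x) x)" by auto
    then show "s \<le> max 0 C"
    proof cases
      case 2
      then show ?thesis using CS[of "R x" x] C[of x] by simp
    qed simp
  qed
  show ?thesis
  proof (cases "A_norm A u = 0")
    case True
    then show ?thesis using CS[of "R u" u] by simp
  next
    case False
    define n where "n = A_norm A u"
    have n: "0 < n" using False nonneg[of u] by (simp add: n_def)
    define x where "x = scaleC (of_real (1 / n)) u"
    have "A_norm A x = 1" using seminorm_scale[of "of_real (1 / n)" u] n
      by (simp add: x_def n_def norm_divide)
    then have "cmod (A_inner A (R x) x) \<le> A_numerical_radius A R"
      unfolding A_numerical_radius_def by (intro cSup_upper bdd) auto
    moreover have "A_inner A (R x) x = A_inner A (R u) u / of_real (n\<^sup>2)"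
      by (simp add: x_def bounded_operatorsD(2)[OF R] form_simps power2_eq_square)
    ultimately show ?thesis using n by (simp add: norm_divide norm_power field_simps n_def)
  qed
qed

text \<open>
  The supremum only tests vectors in \<open>closure (range A)\<close>. A general \<open>u\<close> differs from its component
  \<open>p\<close> there by a vector of the kernel of \<open>A\<close>, which has seminorm zero, and so does its image
  under \<open>R\<close> by \<open>A\<close>-boundedness.
\<close>

lemma A_norm_le_A_op_seminorm:
  fixes A :: "'a::complex_hilbert \<Rightarrow> 'a"
  assumes A: "positive_operator A" and R: "R \<in> bounded_operators"
    and C: "\<And>x. A_norm A (R x) \<le> C * A_norm A x"
  shows "A_norm A (R u) \<le> A_op_seminorm A R * A_norm A u"
proof -
  interpret positive_form "A_inner A" by (rule positive_form_A_inner[OF A])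
  note [simp] = seminorm_A_inner[OF A]
  have nonneg: "0 \<le> A_norm A x" for x using seminorm_nonneg[of x] by simp
  have triangle: "A_norm A (x + y) \<le> A_norm A x + A_norm A y" for x y
    using seminorm_triangle[of x y] by simp
  let ?W = "insert 0 {A_norm A (R x) / A_norm A x | x. x \<in> closure (range A) \<and> x \<noteq> 0}"
  have bdd: "bdd_above ?W"
  proof (rule bdd_aboveI[of _ "max 0 C"])
    fix s assume "s \<in> ?W"
    then consider "s = 0" | x where "s = A_norm A (R x) / A_norm A x" by auto
    then show "s \<le> max 0 C"
    proof cases
      case 2
      then have "s \<le> C \<or> s = 0" using C[of x] nonneg[of x]
        by (cases "A_norm A x = 0") (auto simp: pos_divide_le_eq)
      then show ?thesis by auto
    qed simp
  qed
  obtain p where p: "p \<in> closure (range A)" "A (u - p) = 0"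
    by (rule kernel_closure_range_decomposition[OF A])
  have null: "A_norm A (u - p) = 0" "A_norm A (p - u) = 0"
  proof -
    show "A_norm A (u - p) = 0"
      using p(2) hilbert.diff_left[of 0 0 "u - p"] by (simp add: A_norm_def A_inner_def)
    then show "A_norm A (p - u) = 0" using seminorm_minus[of "u - p"] by simp
  qed
  have Rnull: "A_norm A (R (u - p)) = 0" using C[of "u - p"] null nonneg[of "R (u - p)"] by simp
  have "A_norm A (R u) \<le> A_norm A (R p)"
    using triangle[of "R p" "R (u - p)"] Rnull by (simp add: bounded_operatorsD[OF R])
  also have "\<dots> \<le> A_op_seminorm A R * A_norm A p"
  proof (cases "A_norm A p = 0")
    case True
    then show ?thesis using C[of p] by simp
  next
    case False
    have "A_norm A 0 = 0"
      using seminorm_scale[of 0 0] by (simp add: scaleC_of_real[of 0, simplified])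
    then have "p \<noteq> 0" using False by auto
    then have "A_norm A (R p) / A_norm A p \<le> A_op_seminorm A R"
      unfolding A_op_seminorm_def using p(1) by (intro cSup_upper bdd) auto
    then show ?thesis using False nonneg[of p] by (simp add: field_simps)
  qed
  also have "A_norm A p = A_norm A u"
    using triangle[of u "p - u"] triangle[of p "u - p"] null by simp
  finally show ?thesis .
qed

lemma A_numerical_radius_nonneg:
  fixes A :: "'a::complex_hilbert \<Rightarrow> 'a"
  assumes A: "positive_operator A" and R: "R \<in> bounded_operators"
    and C: "\<And>x. A_norm A (R x) \<le> C * A_norm A x"
  shows "0 \<le> A_numerical_radius A R"
proof (cases "\<exists>x. A_norm A x \<noteq> 0")
  case True
  then obtain x where x: "A_norm A x \<noteq> 0" by blast
  have "0 \<le> A_numerical_radius A R * (A_norm A x)\<^sup>2"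
    using cmod_A_inner_le_numerical_radius[OF A R C, of x] norm_ge_zero order_trans by blast
  with x show ?thesis by (simp add: zero_le_mult_iff)
next
  case False
  then show ?thesis by (simp add: A_numerical_radius_def)
qed

section \<open>The numerical radius of an off-diagonal block operator\<close>

theorem theorem3p14:
  fixes A T1 T2 :: "'h::complex_hilbert \<Rightarrow> 'h"
  assumes "positive_operator A"
    and "T1 \<in> A_adjointable A"
    and "T2 \<in> A_adjointable A"
  shows "let P = (\<lambda>x. A_adjoint A T1 (T1 x) + T2 (A_adjoint A T2 x)) in
    A_numerical_radius (diag_operator A)
        (block_operator null_operator T1 T2 null_operator) ^ 4
      \<le> 1 / 16 * (A_op_seminorm A P)\<^sup>2
        + 1 / 4 * (A_numerical_radius A (T2 \<circ> T1))\<^sup>2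
        + 1 / 8 * A_numerical_radius A (\<lambda>x. P (T2 (T1 x)) + T2 (T1 (P x)))"
proof -
  note A = assms(1)
  interpret positive_form "A_inner A" by (rule positive_form_A_inner[OF A])
  note [simp] = seminorm_A_inner[OF A]
  define S1 where "S1 = A_adjoint A T1"
  define S2 where "S2 = A_adjoint A T2"
  define P where "P = (\<lambda>x. S1 (T1 x) + T2 (S2 x))"
  define R where "R = (\<lambda>x. T2 (T1 x))"
  define V where "V = (\<lambda>x. P (R x) + R (P x))"
  have adj: "adjoint_pair T1 S1" "adjoint_pair T2 S2"
    using A_adjoint(2)[OF A] assms by (auto simp: S1_def S2_def)
  have T_op: "T1 \<in> bounded_operators" "T2 \<in> bounded_operators"
    using assms by (auto simp: A_adjointable_def)
  have S_op: "S1 \<in> bounded_operators" "S2 \<in> bounded_operators"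
    using A_adjoint(1)[OF A] assms by (auto simp: S1_def S2_def)
  have P_op: "P \<in> bounded_operators"
    unfolding P_def
    by (rule bounded_operators_add[OF bounded_operators_comp[OF S_op(1) T_op(1)]
          bounded_operators_comp[OF T_op(2) S_op(2)]])
  have R_op: "R \<in> bounded_operators"
    unfolding R_def by (rule bounded_operators_comp[OF T_op(2,1)])
  have V_op: "V \<in> bounded_operators"
    unfolding V_def
    by (rule bounded_operators_add[OF bounded_operators_comp[OF P_op R_op]
          bounded_operators_comp[OF R_op P_op]])
  have R'_op: "(\<lambda>x. S1 (S2 x)) \<in> bounded_operators"
    by (rule bounded_operators_comp[OF S_op])
  have V'_op: "(\<lambda>x. S1 (S2 (P x)) + P (S1 (S2 x))) \<in> bounded_operators"
    by (rule bounded_operators_add[OF bounded_operators_comp[OF R'_op P_op]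
          bounded_operators_comp[OF P_op R'_op]])
  have P_adj: "adjoint_pair P P"
    unfolding P_def
    by (rule adjoint_pair_add[OF adjoint_pair_comp[OF adjoint_pair_sym[OF adj(1)] adj(1)]
          adjoint_pair_comp[OF adj(2) adjoint_pair_sym[OF adj(2)]]])
  have R_adj: "adjoint_pair R (\<lambda>x. S1 (S2 x))"
    unfolding R_def by (rule adjoint_pair_comp[OF adj(2,1)])
  have V_adj: "adjoint_pair V (\<lambda>x. S1 (S2 (P x)) + P (S1 (S2 x)))"
    unfolding V_def
    by (rule adjoint_pair_add[OF adjoint_pair_comp[OF P_adj R_adj] adjoint_pair_comp[OF R_adj P_adj]])
  obtain CP where CP: "\<And>x. A_norm A (P x) \<le> CP * A_norm A x"
    by (rule A_norm_bounded_if_adjoint_pair[OF A P_op P_op P_adj]) blast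
  obtain CR where CR: "\<And>x. A_norm A (R x) \<le> CR * A_norm A x"
    by (rule A_norm_bounded_if_adjoint_pair[OF A R_op R'_op R_adj]) blast
  obtain CV where CV: "\<And>x. A_norm A (V x) \<le> CV * A_norm A x"
    by (rule A_norm_bounded_if_adjoint_pair[OF A V_op V'_op V_adj]) blast
  define p where "p = A_op_seminorm A P"
  define w where "w = A_numerical_radius A R"
  define v where "v = A_numerical_radius A V"
  define rhs where "rhs = (p\<^sup>2 + 4 * w\<^sup>2 + 2 * v) / 16"
  have "0 \<le> v" unfolding v_def by (rule A_numerical_radius_nonneg[OF A V_op CV])
  then have "0 \<le> rhs" by (simp add: rhs_def)
  have estimate: "cmod (A_inner A (T1 y) x + A_inner A (T2 x) y) ^ 4 \<le> rhs"
    if "(A_norm A x)\<^sup>2 + (A_norm A y)\<^sup>2 = 1" for x y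
    unfolding rhs_def
  proof (rule off_diagonal_form_estimate[OF P_def adj])
    show "seminorm (P u) \<le> p * seminorm u" for u
      using A_norm_le_A_op_seminorm[OF A P_op CP] by (simp add: p_def)
    show "cmod (A_inner A (T2 (T1 u)) u) \<le> w * (seminorm u)\<^sup>2" for u
      using cmod_A_inner_le_numerical_radius[OF A R_op CR, of u] by (simp add: w_def R_def)
    show "cmod (A_inner A (P (T2 (T1 u)) + T2 (T1 (P u))) u) \<le> v * (seminorm u)\<^sup>2" for u
      using cmod_A_inner_le_numerical_radius[OF A V_op CV, of u] by (simp add: v_def V_def R_def)
  qed (use that \<open>0 \<le> v\<close> in simp_all)

  let ?D = "diag_operator A" and ?T = "block_operator null_operator T1 T2 null_operator"
  let ?W = "insert 0 {cmod (A_inner ?D (?T z) z) | z. A_norm ?D z = 1}"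
  have upper: "s \<le> root 4 rhs" if s: "s \<in> ?W" for s
  proof -
    consider "s = 0" | x y where "A_norm ?D (x, y) = 1" "s = cmod (A_inner ?D (?T (x, y)) (x, y))"
      using s by auto
    then show ?thesis
    proof cases
      case 1
      then show ?thesis using \<open>0 \<le> rhs\<close> by simp
    next
      case 2
      have D: "A_inner ?D (a, b) (c, d) = A_inner A a c + A_inner A b d" for a b c d
        by (simp add: A_inner_def diag_operator_def block_operator_def null_operator_def cinner_prod_def)
      have "(A_norm A x)\<^sup>2 + (A_norm A y)\<^sup>2 = 1"
        using 2(1) seminorm_sq[of x] seminorm_sq[of y] by (simp add: A_norm_def[of ?D] D)
      from estimate[OF this] have "s ^ 4 \<le> rhs"
        using 2(2) by (simp add: D block_operator_def null_operator_def)
      then show ?thesis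
        using real_root_le_mono[of 4 "s ^ 4" rhs] 2(2) by (simp add: real_root_power_cancel)
    qed
  qed
  \<comment> \<open>Fourth powers preserve the order only between nonnegative numbers, so the radius of the block
    operator must be shown nonnegative before its bound is raised to the fourth power.\<close>
  then have "bdd_above ?W" by (rule bdd_aboveI)
  then have "0 \<le> A_numerical_radius ?D ?T"
    unfolding A_numerical_radius_def by (intro cSup_upper) auto
  moreover have "A_numerical_radius ?D ?T \<le> root 4 rhs"
    unfolding A_numerical_radius_def by (rule cSup_least) (use upper in auto)
  ultimately have "A_numerical_radius ?D ?T ^ 4 \<le> rhs"
    using power_mono[of "A_numerical_radius ?D ?T" "root 4 rhs" 4] \<open>0 \<le> rhs\<close> by simp
  then show ?thesis
    by (simp add: Let_def rhs_def p_def w_def v_def V_def R_def P_def S1_def S2_def comp_def add_divide_distrib)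
qed

end
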